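(* Let $\Delta=(\Sigma,C,w^\pm)$ be a complete simplicial multi-fan of dimension $n$. Then $$\sum_{q=0}^n h_q(\Delta)(s+1)^q=\sum_{m=0}^n e_{n-m}(\Delta)s^m,$$ where $s$ is an indeterminate.
   Context: **Multi-fans.** Let $N$ be a lattice of rank $n$ and $V=N_{\mathbb R}=N\otimes\mathbb R$. A cone in $N$ is a strongly convex rational polyhedral cone in $N_{\mathbb R}$ (the set of nonnegative real combinations of finitely many vectors of $N$, containing no line). $\mathrm{Cone}(N)$ is the set of all cones, partially ordered by $\tau\prec\sigma$ iff $\tau$ is a proper face of $\sigma$. A multi-fan of dimension $n$ in $N$ is a triple $\Delta=(\Sigma,C,w^{\pm})$ where $\Sigma$ is a finite partially ordered set with a unique minimum element $*$; $C:\Sigma\to\mathrm{Cone}(N)$ is a map with (1) $C( * )=\{0\}$, (2) $I<J$ implies $C(I)\prec C(J)$, (3) for each $J\in\Sigma$, $C$ restricts to an isomorphism of ordered sets from $\{I\in\Sigma: I\le J\}$ onto $\{\kappa\in\mathrm{Cone}(N):\kappa\preceq C(J)\}$; and, with $\Sigma^{(m)}=\{I\in\Sigma:\dim C(I)=m\}$ (write $|I|=m$ for $I\in\Sigma^{(m)}$), $w^+,w^-:\Sigma^{(n)}\to\mathbb Z_{\ge0}$ are functions such that $w^+(I)>0$ or $w^-(I)>0$ for each $I$. Put $w=w^+-w^-$. A vector $v\in N_{\mathbb R}$ is generic if it lies on no linear subspace spanned by a cone $C(I)$ of dimension $<n$. $\Delta$ is pre-complete if $\Sigma^{(n)}\ne\emptyset$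 and $d_v=\sum_{v\in C(I),\,I\in\Sigma^{(n)}}w(I)$ is independent of the generic vector $v$; this integer is $\deg(\Delta)$. For $K\in\Sigma$ the projected multi-fan $\Delta_K=(\Sigma_K,C_K,w_K^\pm)$ has $\Sigma_K=\{J\in\Sigma:K\le J\}$, $C_K(J)$ = the image of $C(J)$ in the quotient of $N_{\mathbb R}$ by the span of $C(K)$ (with lattice the quotient of $N$ by the subgroup generated by $C(K)\cap N$), and $w_K^\pm$ the restrictions of $w^\pm$. $\Delta$ is complete if $\Delta$ and all $\Delta_K$, $K\in\Sigma$, are pre-complete. $\Delta$ is simplicial if every $C(I)$ is generated by linearly independent vectors; then $\Sigma$ is identified with an augmented simplicial set (abstract simplicial complex including the empty set as minimum) of subsets of $\{1,\dots,d\}$ with $\Sigma^{(1)}=\{\{1\},\dots,\{d\}\}$, and $|I|$ is the cardinality of $I$. **The numbers $h_q$ and $e_q$.** Let $\Delta$ be complete and simplicial, $v_i$ a nonzero vector in $C(\{i\})$, and $v\in V$ a generic vector. For $I\in\Sigma^{(n)}$ write $v=\sum_{i\in I}a_iv_i$ (all $a_i\ne0$) and put $\mu(I)=\sharp\{i\in I:a_i>0\}$. For $0\le q\le n$, $h_q(\Delta)=\sum_{I\in\Sigma^{(n)},\,\mu(I)=q}w(I)$ (defined using the chosen $v$) and $e_q(\Delta)=\sum_{K\in\Sigma^{(q)}}\deg(\Delta_K)$. *)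

theory Defs
  imports "HOL-Analysis.Analysis" "HOL-Computational_Algebra.Polynomial"
begin

section \<open>Lattices and cones\<close>

text \<open>
  A lattice is represented inside the real vector space that it spans: \<^term>\<open>span N\<close> plays
  the role of \<open>N \<otimes> \<real>\<close>, and the rank of \<open>N\<close> is \<^term>\<open>dim N\<close>. The ambient type may be larger than
  \<^term>\<open>span N\<close>, so that lattices of all ranks, including \<open>0\<close>, live in one type.
\<close>

definition is_lattice :: "'a::real_vector set \<Rightarrow> bool" where
  "is_lattice N \<longleftrightarrow>
     (\<exists>B. finite B \<and> independent B \<and> N = range (\<lambda>c::'a \<Rightarrow> int. \<Sum>b\<in>B. of_int (c b) *\<^sub>R b))"

definition contains_line :: "'a::real_vector set \<Rightarrow> bool" where
  "contains_line S \<longleftrightarrow> (\<exists>a b. b \<noteq> 0 \<and> (\<forall>t::real. a + t *\<^sub>R b \<in> S))"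

definition cones :: "'a::real_vector set \<Rightarrow> 'a set set" where
  "cones N = {\<sigma>. (\<exists>S. finite S \<and> S \<subseteq> N \<and> \<sigma> = convex_cone hull S) \<and> \<not> contains_line \<sigma>}"


section \<open>Multi-fans\<close>

text \<open>
  The finite poset \<open>\<Sigma>\<close> is a finite subset of a partially ordered type. The weight functions are
  total, but only their values on the cells of top dimension are ever used.
\<close>

record ('i, 'a) multifan =
  lattice :: "'a set"
  cells :: "'i set"
  cone_of :: "'i \<Rightarrow> 'a set"
  wplus :: "'i \<Rightarrow> nat"
  wminus :: "'i \<Rightarrow> nat"

definition mf_rank :: "('i, 'a::real_vector) multifan \<Rightarrow> nat" where
  "mf_rank \<Delta> = dim (lattice \<Delta>)"

definition cells_of_dim :: "('i, 'a::real_vector) multifan \<Rightarrow> nat \<Rightarrow> 'i set" where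
  "cells_of_dim \<Delta> m = {I \<in> cells \<Delta>. dim (cone_of \<Delta> I) = m}"

definition weight :: "('i, 'a) multifan \<Rightarrow> 'i \<Rightarrow> int" where
  "weight \<Delta> I = int (wplus \<Delta> I) - int (wminus \<Delta> I)"

text \<open>
  The order on cones is the face relation; \<^term>\<open>\<kappa> face_of \<sigma>\<close> includes \<open>\<kappa> = \<sigma>\<close>.
  It also admits \<open>\<kappa> = {}\<close>, which is excluded because members of \<^term>\<open>cones N\<close> contain \<open>0\<close>.
\<close>

definition is_multifan :: "('i::order, 'a::real_vector) multifan \<Rightarrow> bool" where
  "is_multifan \<Delta> \<longleftrightarrow>
     is_lattice (lattice \<Delta>) \<and>
     finite (cells \<Delta>) \<and>
     (\<forall>I\<in>cells \<Delta>. cone_of \<Delta> I \<in> cones (lattice \<Delta>)) \<and>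
     (\<exists>z\<in>cells \<Delta>. (\<forall>I\<in>cells \<Delta>. z \<le> I) \<and> cone_of \<Delta> z = {0}) \<and>
     (\<forall>I\<in>cells \<Delta>. \<forall>J\<in>cells \<Delta>. I < J \<longrightarrow>
        cone_of \<Delta> I face_of cone_of \<Delta> J \<and> cone_of \<Delta> I \<noteq> cone_of \<Delta> J) \<and>
     (\<forall>J\<in>cells \<Delta>.
        bij_betw (cone_of \<Delta>) {I \<in> cells \<Delta>. I \<le> J}
          {\<kappa> \<in> cones (lattice \<Delta>). \<kappa> face_of cone_of \<Delta> J} \<and>
        (\<forall>I\<in>cells \<Delta>. \<forall>I'\<in>cells \<Delta>. I \<le> J \<longrightarrow> I' \<le> J \<longrightarrow>
           (I \<le> I' \<longleftrightarrow> cone_of \<Delta> I face_of cone_of \<Delta> I'))) \<and>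
     (\<forall>I\<in>cells_of_dim \<Delta> (mf_rank \<Delta>). wplus \<Delta> I > 0 \<or> wminus \<Delta> I > 0)"

definition generic :: "('i, 'a::real_vector) multifan \<Rightarrow> 'a \<Rightarrow> bool" where
  "generic \<Delta> v \<longleftrightarrow> v \<in> span (lattice \<Delta>) \<and>
     (\<forall>I\<in>cells \<Delta>. dim (cone_of \<Delta> I) < mf_rank \<Delta> \<longrightarrow> v \<notin> span (cone_of \<Delta> I))"

definition local_degree :: "('i, 'a::real_vector) multifan \<Rightarrow> 'a \<Rightarrow> int" where
  "local_degree \<Delta> v = (\<Sum>I | I \<in> cells_of_dim \<Delta> (mf_rank \<Delta>) \<and> v \<in> cone_of \<Delta> I. weight \<Delta> I)"

definition pre_complete :: "('i, 'a::real_vector) multifan \<Rightarrow> bool" where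
  "pre_complete \<Delta> \<longleftrightarrow> cells_of_dim \<Delta> (mf_rank \<Delta>) \<noteq> {} \<and>
     (\<exists>d. \<forall>v. generic \<Delta> v \<longrightarrow> local_degree \<Delta> v = d)"

definition mf_degree :: "('i, 'a::real_vector) multifan \<Rightarrow> int" where
  "mf_degree \<Delta> = (THE d. \<forall>v. generic \<Delta> v \<longrightarrow> local_degree \<Delta> v = d)"


section \<open>Projected multi-fans\<close>

text \<open>
  The quotient by a subspace \<open>W\<close> is realized as the image of a linear map with kernel \<open>W\<close>.
  Such a map exists (see below), and any two choices differ by a linear isomorphism of the
  images.
\<close>

definition quotient_map :: "'a::real_vector set \<Rightarrow> 'a \<Rightarrow> 'a" where
  "quotient_map W = (SOME \<pi>. linear \<pi> \<and> {x. \<pi> x = 0} = W)"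

lemma quotient_map:
  fixes W :: "'a::real_vector set"
  assumes "subspace W"
  shows "linear (quotient_map W)" and "quotient_map W x = 0 \<longleftrightarrow> x \<in> W"
proof -
  have "linear (\<lambda>x::'a. x)"
    by (simp add: linear_iff)
  then obtain g :: "'a \<Rightarrow> 'a" where g: "range g \<subseteq> W" "linear g" "\<forall>v\<in>W. g v = v"
    using real_vector.linear_exists_left_inverse_on[of "\<lambda>x. x" W] assms by auto
  have "linear (\<lambda>x. x - g x) \<and> {x. x - g x = 0} = W"
    using g by (auto simp: linear_compose_sub linear_iff algebra_simps)
  then have "linear (quotient_map W) \<and> {x. quotient_map W x = 0} = W"
    unfolding quotient_map_def by (rule someI[where P = "\<lambda>\<pi>. linear \<pi> \<and> {x. \<pi> x = 0} = W"])
  then show "linear (quotient_map W)" and "quotient_map W x = 0 \<longleftrightarrow> x \<in> W"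
    by auto
qed

text \<open>
  For \<open>W = span C(K)\<close> with \<open>C(K)\<close> rational, the subgroup of \<open>N\<close> generated by \<open>C(K) \<inter> N\<close> is
  \<open>N \<inter> W\<close>, so the image of \<open>N\<close> under \<^term>\<open>quotient_map W\<close> is the quotient lattice.
\<close>

definition projected :: "('i::order, 'a::real_vector) multifan \<Rightarrow> 'i \<Rightarrow> ('i, 'a) multifan" where
  "projected \<Delta> K = (let \<pi> = quotient_map (span (cone_of \<Delta> K)) in
     \<lparr> lattice = \<pi> ` lattice \<Delta>,
       cells = {J \<in> cells \<Delta>. K \<le> J},
       cone_of = (\<lambda>J. \<pi> ` cone_of \<Delta> J),
       wplus = wplus \<Delta>,
       wminus = wminus \<Delta> \<rparr>)"

definition complete_multifan :: "('i::order, 'a::real_vector) multifan \<Rightarrow> bool" where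
  "complete_multifan \<Delta> \<longleftrightarrow> pre_complete \<Delta> \<and> (\<forall>K\<in>cells \<Delta>. pre_complete (projected \<Delta> K))"


section \<open>Simplicial multi-fans and the numbers h and e\<close>

definition simplicial :: "('i, 'a::real_vector) multifan \<Rightarrow> bool" where
  "simplicial \<Delta> \<longleftrightarrow>
     (\<forall>I\<in>cells \<Delta>. \<exists>S. finite S \<and> independent S \<and> cone_of \<Delta> I = convex_cone hull S)"

text \<open>
  In the simplicial case a cell \<open>I\<close> is identified with the set of one-dimensional cells below
  it; these are the \<open>i \<in> I\<close> in \<open>v = (\<Sum>i\<in>I. a\<^sub>i v\<^sub>i)\<close>.
\<close>

definition vertices :: "('i::order, 'a::real_vector) multifan \<Rightarrow> 'i \<Rightarrow> 'i set" where
  "vertices \<Delta> I = {i \<in> cells_of_dim \<Delta> 1. i \<le> I}"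

text \<open>The argument \<open>u\<close> gives the vectors \<open>v\<^sub>i\<close>.\<close>

definition mu :: "('i::order, 'a::real_vector) multifan \<Rightarrow> ('i \<Rightarrow> 'a) \<Rightarrow> 'a \<Rightarrow> 'i \<Rightarrow> nat" where
  "mu \<Delta> u v I = card {i \<in> vertices \<Delta> I. representation (u ` vertices \<Delta> I) v (u i) > 0}"

definition h_number ::
    "('i::order, 'a::real_vector) multifan \<Rightarrow> ('i \<Rightarrow> 'a) \<Rightarrow> 'a \<Rightarrow> nat \<Rightarrow> int" where
  "h_number \<Delta> u v q = (\<Sum>I | I \<in> cells_of_dim \<Delta> (mf_rank \<Delta>) \<and> mu \<Delta> u v I = q. weight \<Delta> I)"

definition e_number :: "('i::order, 'a::real_vector) multifan \<Rightarrow> nat \<Rightarrow> int" where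
  "e_number \<Delta> q = (\<Sum>K\<in>cells_of_dim \<Delta> q. mf_degree (projected \<Delta> K))"

end

theory Submission
  imports Defs
begin

text \<open>
  The degree of \<open>\<Delta>\<^sub>K\<close> can be computed at the image of \<open>v\<close>, which is again generic. For a maximal
  cell \<open>J \<ge> K\<close> that image lies in the image of \<open>C(J)\<close> iff the coordinates \<open>a\<^sub>i\<close> of \<open>v\<close> with
  \<open>i \<in> J - K\<close> are positive. Hence \<open>w(J)\<close> is counted in \<open>e\<^sub>n\<^sub>-\<^sub>m\<close> once for each \<open>m\<close>-element
  subset \<open>J - K\<close> of \<open>{i \<in> J. a\<^sub>i > 0}\<close>, that is, \<open>\<mu>(J) choose m\<close> times, and the binomial theorem
  identifies this with the coefficient of \<open>s\<^sup>m\<close> in \<open>w(J) (s + 1)\<^sup>\<mu>\<^sup>(\<^sup>J\<^sup>)\<close>.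
\<close>

section \<open>Linear algebra: independence by counting, and the dimension of an image\<close>

text \<open>A maximal independent subset of \<open>B\<close> still spans \<open>S\<close>, so it has
  at least \<open>card S\<close> elements and must be all of \<open>B\<close>.\<close>

lemma independent_if_card_le:
  fixes B S :: "'a::real_vector set"
  assumes "finite B" "independent S" "S \<subseteq> span B" "card B \<le> card S"
  shows "independent B"
proof -
  obtain A where A: "A \<subseteq> B" "independent A" "B \<subseteq> span A"
    using real_vector.maximal_independent_subset by blast
  have "finite A" using A assms(1) finite_subset by blast
  moreover have "S \<subseteq> span A"
    using assms(3) A(3) real_vector.span_minimal[OF A(3)] by auto
  ultimately have "card S \<le> card A"
    using real_vector.independent_span_bound assms(2) by blast
  then have "A = B"
    using A(1) assms(1,4) by (meson card_seteq order_trans)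
  then show ?thesis using A(2) by simp
qed

text \<open>Rank-nullity in a possibly infinite-dimensional ambient space, where \<open>F\<close>
  bounds the dimension of \<open>span V\<close>. A basis of \<open>span W\<close> is extended to one
  of \<open>span V\<close>; \<open>f\<close> kills the old vectors and is injective on the span of
  the new ones.\<close>

lemma dim_linear_image_add_dim_kernel:
  fixes f :: "'a::real_vector \<Rightarrow> 'b::real_vector"
  assumes f: "linear f" and ker: "\<And>x. f x = 0 \<longleftrightarrow> x \<in> span W" and W: "W \<subseteq> span V"
    and fin: "finite F" "V \<subseteq> span F"
  shows "dim (f ` V) + dim W = dim V"
proof -
  obtain T where T: "T \<subseteq> W" "independent T" "W \<subseteq> span T"
    using real_vector.maximal_independent_subset by blast
  have sT: "span T = span W"
    using T by (metis real_vector.span_eq order_trans real_vector.span_superset)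
  obtain S where S: "T \<subseteq> S" "S \<subseteq> span V" "independent S" "span V \<subseteq> span S"
    using real_vector.maximal_independent_subset_extend[of T "span V"] T W by blast
  have sS: "span S = span V"
    using S by (simp add: real_vector.span_minimal subset_antisym)
  have "finite S"
    using real_vector.independent_span_bound[OF fin(1) S(3)] S(2) real_vector.span_minimal[OF fin(2)]
    by auto
  have ST: "independent (S - T)"
    using S(3) real_vector.dependent_mono by blast
  have inj: "inj_on f (span (S - T))"
  proof -
    \<comment> \<open>Such an \<open>x\<close> lies in both \<open>span (S - T)\<close> and
      \<open>span T\<close>, so every coordinate relative to \<open>S\<close> is zero.\<close>
    have "x = 0" if x: "x \<in> span (S - T)" "f x = 0" for x
    proof -
      have xT: "x \<in> span T" using x(2) ker sT by simp
      have "representation S x = representation (S - T) x" "representation S x = representation T x"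
        using real_vector.representation_extend S(1,3) x(1) xT by blast+
      then have "representation S x b = 0" for b
        using real_vector.representation_ne_zero[of "S - T" x b]
          real_vector.representation_ne_zero[of T x b] by auto
      moreover have "x \<in> span S" using xT S(1) real_vector.span_mono by blast
      ultimately show ?thesis
        using real_vector.sum_nonzero_representation_eq[OF S(3), of x] by simp
    qed
    then show ?thesis
      using real_vector.linear_inj_on_iff_eq_0[OF f real_vector.subspace_span] by blast
  qed
  have "span (f ` V) = span (f ` (S - T))"
  proof -
    have "f ` T \<subseteq> {0}" using ker sT real_vector.span_superset by blast
    then have "span (f ` S) = span (f ` (S - T))"
      using S(1) by (metis Un_Diff_cancel Un_absorb1 image_Un insert_is_Un
          real_vector.span_insert_0 subset_singleton_iff sup_bot_left)
    then show ?thesis using real_vector.linear_span_image[OF f] sS by metis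
  qed
  moreover have "independent (f ` (S - T))"
    using real_vector.linear_independent_injective_image[OF f ST inj] .
  moreover have "card (f ` (S - T)) = card S - card T"
    using inj \<open>finite S\<close> S(1)
    by (metis card_Diff_subset card_image finite_subset inj_on_subset real_vector.span_superset)
  ultimately have "dim (f ` V) = card S - card T"
    using real_vector.dim_eq_card by metis
  moreover have "dim W = card T"
    using T(2) sT real_vector.dim_eq_card by metis
  moreover have "dim V = card S"
    using S(3) sS real_vector.dim_eq_card by metis
  ultimately show ?thesis
    using card_mono[OF \<open>finite S\<close> S(1)] by simp
qed

section \<open>Finitely generated convex cones and their faces\<close>

lemma convex_cone_sum:
  assumes "convex_cone K" "\<And>i. i \<in> A \<Longrightarrow> x i \<in> K"
  shows "sum x A \<in> K"
  using assms(2) by (induction A rule: infinite_finite_induct)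
    (auto simp: convex_cone_contains_0[OF assms(1)] convex_cone_add[OF assms(1)])

lemma convex_cone_hull_finite:
  fixes S :: "'a::real_vector set"
  assumes "finite S"
  shows "convex_cone hull S = {x. \<exists>c. (\<forall>s\<in>S. 0 \<le> c s) \<and> x = (\<Sum>s\<in>S. c s *\<^sub>R s)}" (is "_ = ?R")
proof (rule hull_unique)
  show "S \<subseteq> ?R"
  proof
    fix s assume "s \<in> S"
    then have "s = (\<Sum>t\<in>S. (if t = s then 1 else 0) *\<^sub>R t)"
      using assms by (simp add: if_distrib[of "\<lambda>a. a *\<^sub>R _"] sum.delta cong: if_cong)
    then show "s \<in> ?R"
      by (intro CollectI exI[of _ "\<lambda>t. if t = s then 1 else 0"]) auto
  qed
  show "convex_cone ?R"
    unfolding convex_cone_iff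
  proof (intro conjI ballI allI impI)
    show "0 \<in> ?R" by (intro CollectI exI[of _ "\<lambda>_. 0"]) simp
  next
    fix x y assume "x \<in> ?R" "y \<in> ?R"
    then obtain c d where "\<forall>s\<in>S. 0 \<le> c s" "x = (\<Sum>s\<in>S. c s *\<^sub>R s)"
      "\<forall>s\<in>S. 0 \<le> d s" "y = (\<Sum>s\<in>S. d s *\<^sub>R s)" by blast
    then show "x + y \<in> ?R"
      by (intro CollectI exI[of _ "\<lambda>s. c s + d s"]) (simp add: scaleR_add_left sum.distrib)
  next
    fix x and r :: real assume "x \<in> ?R" "0 \<le> r"
    then obtain c where "\<forall>s\<in>S. 0 \<le> c s" "x = (\<Sum>s\<in>S. c s *\<^sub>R s)" by blast
    with \<open>0 \<le> r\<close> show "r *\<^sub>R x \<in> ?R"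
      by (intro CollectI exI[of _ "\<lambda>s. r * c s"]) (simp add: scaleR_sum_right)
  qed
  fix K assume K: "S \<subseteq> K" "convex_cone K"
  then show "?R \<subseteq> K"
    by (auto intro!: convex_cone_sum convex_cone_scaleR)
qed

lemma span_convex_cone_hull: "span (convex_cone hull S) = span S"
proof (rule subset_antisym)
  have "convex_cone hull S \<subseteq> span S"
    by (simp add: convex_cone_span hull_minimal real_vector.span_superset)
  then show "span (convex_cone hull S) \<subseteq> span S"
    by (simp add: real_vector.span_minimal)
qed (simp add: hull_subset real_vector.span_mono)

lemma dim_convex_cone_hull: "independent S \<Longrightarrow> dim (convex_cone hull S) = card S"
  by (metis real_vector.dim_eq_card span_convex_cone_hull)

lemma face_of_convex_cone_imp_convex_cone:
  assumes "convex_cone C" "K face_of C" "K \<noteq> {}"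
  shows "convex_cone K"
  using assms face_of_conic face_of_imp_convex unfolding convex_cone_def by blast

text \<open>\<open>x + y\<close> is the midpoint of \<open>2 *\<^sub>R x\<close> and
  \<open>2 *\<^sub>R y\<close>, so the face property puts \<open>2 *\<^sub>R x\<close> into
  \<open>K\<close>, and \<open>K\<close>, itself a cone, is closed under halving. For
  \<open>x = y\<close> the open segment is empty, but then \<open>x + y\<close> is already
  \<open>2 *\<^sub>R x\<close>.\<close>

lemma face_of_convex_cone_add:
  assumes C: "convex_cone C" and K: "K face_of C" and xy: "x \<in> C" "y \<in> C" "x + y \<in> K"
  shows "x \<in> K"
proof -
  have cK: "convex_cone K"
    using face_of_convex_cone_imp_convex_cone[OF C K] xy(3) by blast
  have C2: "2 *\<^sub>R x \<in> C" "2 *\<^sub>R y \<in> C"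
    using C xy convex_cone_scaleR by force+
  have half: "x \<in> K" if "2 *\<^sub>R x \<in> K"
    using convex_cone_scaleR[OF cK _ that, of "1/2"] by simp
  show ?thesis
  proof (cases "x = y")
    case True
    then show ?thesis using xy(3) half by (simp add: scaleR_2)
  next
    case False
    then have "x + y \<in> open_segment (2 *\<^sub>R x) (2 *\<^sub>R y)"
      unfolding in_segment by (intro conjI exI[of _ "1/2"]) auto
    then show ?thesis using face_ofD[OF K _ C2 xy(3)] half by blast
  qed
qed

text \<open>A face contains every summand of each of its elements. In a conic combination lying in
  \<open>K\<close>, each generator with nonzero coefficient therefore lies in
  \<open>K\<close>.\<close>

lemma face_of_convex_cone_hull:
  fixes F :: "'a::real_vector set"
  assumes F: "finite F" and K: "K face_of convex_cone hull F" "K \<noteq> {}"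
  shows "K = convex_cone hull (F \<inter> K)"
proof
  note cc = convex_cone_convex_cone_hull[of F]
  have cK: "convex_cone K"
    using face_of_convex_cone_imp_convex_cone[OF cc K] .
  then show "convex_cone hull (F \<inter> K) \<subseteq> K"
    by (simp add: hull_minimal)
  show "K \<subseteq> convex_cone hull (F \<inter> K)"
  proof
    fix x assume x: "x \<in> K"
    then have "x \<in> convex_cone hull F" using K(1) face_of_imp_subset by blast
    then obtain c where c: "\<forall>s\<in>F. 0 \<le> c s" "x = (\<Sum>s\<in>F. c s *\<^sub>R s)"
      unfolding convex_cone_hull_finite[OF F] by blast
    have mem: "c s *\<^sub>R s \<in> convex_cone hull (F \<inter> K)" if s: "s \<in> F" for s
    proof (cases "c s = 0")
      case True
      then show ?thesis by (simp add: convex_cone_hull_contains_0)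
    next
      case False
      have in_hull: "c t *\<^sub>R t \<in> convex_cone hull F" if "t \<in> F" for t
        using that c(1) by (simp add: convex_cone_hull_mul hull_inc)
      have "c s *\<^sub>R s + (\<Sum>t\<in>F - {s}. c t *\<^sub>R t) \<in> K"
        using x c(2) F s by (simp add: sum.remove)
      then have "c s *\<^sub>R s \<in> K"
        using face_of_convex_cone_add[OF cc K(1) in_hull[OF s]]
          convex_cone_sum[OF cc, of "F - {s}" "\<lambda>t. c t *\<^sub>R t"] in_hull by blast
      then have "s \<in> K"
        using convex_cone_scaleR[OF cK, of "inverse (c s)" "c s *\<^sub>R s"] c(1) s False by simp
      then show ?thesis
        using s c(1) by (simp add: convex_cone_hull_mul hull_inc)
    qed
    then show "x \<in> convex_cone hull (F \<inter> K)"
      unfolding c(2) by (simp add: convex_cone_sum convex_cone_convex_cone_hull)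
  qed
qed

section \<open>Simplicial cones in coordinates\<close>

lemma in_span_subset_iff_representation:
  fixes S :: "'a::real_vector set"
  assumes S: "independent S" and T: "T \<subseteq> S"
  shows "x \<in> span T \<longleftrightarrow> x \<in> span S \<and> (\<forall>s\<in>S - T. representation S x s = 0)"
proof (intro iffI conjI ballI)
  assume x: "x \<in> span T"
  then show "x \<in> span S" using real_vector.span_mono[OF T] by blast
  fix s assume "s \<in> S - T"
  then show "representation S x s = 0"
    using real_vector.representation_extend[OF S x T]
      real_vector.representation_ne_zero[of T x s] by auto
next
  assume x: "x \<in> span S \<and> (\<forall>s\<in>S - T. representation S x s = 0)"
  then have "{s. representation S x s \<noteq> 0} \<subseteq> T"
    using real_vector.representation_ne_zero[of S x] by blast
  then have "(\<Sum>s | representation S x s \<noteq> 0. representation S x s *\<^sub>R s) \<in> span T"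
    by (intro real_vector.span_sum real_vector.span_scale real_vector.span_base) auto
  then show "x \<in> span T"
    using real_vector.sum_nonzero_representation_eq[OF S] x by simp
qed

text \<open>Coordinates are taken relative to all of \<open>S\<close>, so that membership in every
  face is tested in one coordinate system.\<close>

lemma in_convex_cone_hull_iff_representation:
  fixes S :: "'a::real_vector set"
  assumes fin: "finite S" and S: "independent S" and T: "T \<subseteq> S"
  shows "x \<in> convex_cone hull T \<longleftrightarrow> x \<in> span T \<and> (\<forall>s\<in>S. 0 \<le> representation S x s)"
proof (intro iffI conjI ballI)
  have finT: "finite T" using fin T finite_subset by blast
  {
    assume x: "x \<in> convex_cone hull T"
    then show xT: "x \<in> span T"
      using span_convex_cone_hull real_vector.span_base by blast
    obtain c where c: "\<forall>s\<in>T. 0 \<le> c s" "x = (\<Sum>s\<in>T. c s *\<^sub>R s)"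
      using x unfolding convex_cone_hull_finite[OF finT] by blast
    fix s assume "s \<in> S"
    have T': "t \<in> S" "t \<in> span S" if "t \<in> T" for t
      using that T real_vector.span_base by blast+
    have "representation S x s = (\<Sum>t\<in>T. c t * (if s = t then 1 else 0))"
      unfolding c(2) using T'
      by (subst real_vector.representation_sum[OF S])
        (auto simp: real_vector.span_scale real_vector.representation_scale[OF S]
            real_vector.representation_basis[OF S] intro!: sum.cong)
    also have "\<dots> \<ge> 0" using c(1) by (intro sum_nonneg) auto
    finally show "0 \<le> representation S x s" .
  }
  assume x: "x \<in> span T \<and> (\<forall>s\<in>S. 0 \<le> representation S x s)"
  then have "x \<in> span S" "\<forall>s\<in>S - T. representation S x s = 0"
    using in_span_subset_iff_representation[OF S T] by auto
  then have "x = (\<Sum>s\<in>T. representation S x s *\<^sub>R s)"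
    using real_vector.sum_representation_eq[OF S _ fin, of x] T fin
    by (subst sum.mono_neutral_left[OF fin T]) auto
  then show "x \<in> convex_cone hull T"
    unfolding convex_cone_hull_finite[OF finT]
    using x T by (intro CollectI exI[of _ "representation S x"]) auto
qed

text \<open>An element of \<open>S\<close> has coordinate 1 at itself, whereas points of
  \<open>span T\<close> have coordinate 0 off \<open>T\<close>.\<close>

lemma independent_Int_convex_cone_hull:
  fixes S :: "'a::real_vector set"
  assumes "independent S" "T \<subseteq> S"
  shows "S \<inter> (convex_cone hull T) = T"
proof
  show "T \<subseteq> S \<inter> (convex_cone hull T)" using assms(2) by (simp add: hull_subset)
  show "S \<inter> (convex_cone hull T) \<subseteq> T"
  proof
    fix s assume s: "s \<in> S \<inter> (convex_cone hull T)"
    then have "s \<in> span T" using span_convex_cone_hull real_vector.span_base by blast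
    then show "s \<in> T"
      using s assms in_span_subset_iff_representation[OF assms, of s]
        real_vector.representation_basis[OF assms(1), of s] by (cases "s \<in> T") force+
  qed
qed

text \<open>Inside an open segment each coordinate is a positive combination of the two nonnegative
  endpoint coordinates; where it vanishes, both of them do.\<close>

lemma convex_cone_hull_subset_face_of:
  fixes S :: "'a::real_vector set"
  assumes fin: "finite S" and S: "independent S" and T: "T \<subseteq> S"
  shows "convex_cone hull T face_of convex_cone hull S"
  unfolding face_of_def
proof (intro conjI ballI impI)
  show "convex_cone hull T \<subseteq> convex_cone hull S" using T by (rule hull_mono)
  show "convex (convex_cone hull T)" by (rule convex_convex_cone_hull)
  fix a b x
  assume a: "a \<in> convex_cone hull S" and b: "b \<in> convex_cone hull S"
    and x: "x \<in> convex_cone hull T" and seg: "x \<in> open_segment a b"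
  obtain t where t: "0 < t" "t < 1" "x = (1 - t) *\<^sub>R a + t *\<^sub>R b"
    using seg unfolding in_segment by blast
  let ?r = "representation S"
  have a': "a \<in> span S" "\<forall>s\<in>S. 0 \<le> ?r a s" and b': "b \<in> span S" "\<forall>s\<in>S. 0 \<le> ?r b s"
    using a b in_convex_cone_hull_iff_representation[OF fin S order_refl] by auto
  have rx: "?r x s = (1 - t) * ?r a s + t * ?r b s" for s
    unfolding t(3) using a' b'
    by (simp add: real_vector.representation_add[OF S] real_vector.representation_scale[OF S]
        real_vector.span_scale)
  have "?r a s = 0 \<and> ?r b s = 0" if s: "s \<in> S - T" for s
  proof -
    have "?r x s = 0"
      using x s in_convex_cone_hull_iff_representation[OF fin S T]
        in_span_subset_iff_representation[OF S T] by blast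
    moreover have "0 \<le> (1 - t) * ?r a s" "0 \<le> t * ?r b s" using a' b' s t by auto
    ultimately have "(1 - t) * ?r a s = 0" "t * ?r b s = 0" using rx[of s] by linarith+
    then show ?thesis using t by auto
  qed
  then show "a \<in> convex_cone hull T" "b \<in> convex_cone hull T"
    using a' b' in_convex_cone_hull_iff_representation[OF fin S T]
      in_span_subset_iff_representation[OF S T] by blast+
qed

text \<open>Rationality is inherited, because a face is generated by some of the lattice vectors
  that generate \<open>C\<close>.\<close>

lemma face_in_cones:
  assumes C: "C \<in> cones N" and K: "K face_of C" "K \<noteq> {}"
  shows "K \<in> cones N"
proof -
  obtain F where F: "finite F" "F \<subseteq> N" "C = convex_cone hull F" "\<not> contains_line C"
    using C unfolding cones_def by blast
  then have "K = convex_cone hull (F \<inter> K)"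
    using face_of_convex_cone_hull K by blast
  moreover have "\<not> contains_line K"
    using F(4) face_of_imp_subset[OF K(1)] unfolding contains_line_def by blast
  ultimately show ?thesis
    unfolding cones_def using F(1,2)
    by (intro CollectI conjI exI[of _ "F \<inter> K"]) auto
qed

text \<open>The face lattice of a simplicial cone is Boolean: a face is recovered from the
  generators it contains, and every set of generators occurs.\<close>

lemma bij_betw_faces_subsets:
  fixes S :: "'a::real_vector set"
  assumes fin: "finite S" and S: "independent S" and C: "convex_cone hull S \<in> cones N"
  shows "bij_betw (\<lambda>K. S \<inter> K) {K \<in> cones N. K face_of convex_cone hull S} (Pow S)"
proof (rule bij_betw_byWitness[where f' = "\<lambda>T. convex_cone hull T"])
  \<comment> \<open>The empty set also counts as a face and, like \<open>{0}\<close> when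
    \<open>0 \<notin> S\<close>, contains no generator; membership in \<open>cones N\<close> rules
    it out.\<close>
  have ne: "K \<noteq> {}" if "K \<in> cones N" for K
    using that convex_cone_hull_nonempty unfolding cones_def by blast
  show "\<forall>K\<in>{K \<in> cones N. K face_of convex_cone hull S}. convex_cone hull (S \<inter> K) = K"
    using face_of_convex_cone_hull[OF fin] ne by blast
  show "\<forall>T\<in>Pow S. S \<inter> (convex_cone hull T) = T"
    using independent_Int_convex_cone_hull[OF S] by blast
  show "(\<lambda>T. convex_cone hull T) ` Pow S \<subseteq> {K \<in> cones N. K face_of convex_cone hull S}"
    using convex_cone_hull_subset_face_of[OF fin S] face_in_cones[OF C]
    by (auto simp: convex_cone_hull_nonempty)
qed auto

text \<open>Modulo \<open>span T\<close> only the coordinates off \<open>T\<close> are visible, and those on \<open>T\<close> can be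
  changed freely.\<close>
lemma linear_image_in_simplicial_cone_iff:
  fixes S :: "'a::real_vector set"
  assumes fin: "finite S" and S: "independent S" and T: "T \<subseteq> S" and v: "v \<in> span S"
    and f: "linear f" and ker: "\<And>x. f x = 0 \<longleftrightarrow> x \<in> span T"
  shows "f v \<in> f ` (convex_cone hull S) \<longleftrightarrow> (\<forall>s\<in>S - T. 0 \<le> representation S v s)"
proof -
  let ?r = "representation S"
  have eq: "f v = f x \<longleftrightarrow> (\<forall>s\<in>S - T. ?r v s = ?r x s)" if x: "x \<in> span S" for x
  proof -
    have "f v = f x \<longleftrightarrow> v - x \<in> span T" by (simp add: ker[symmetric] real_vector.linear_diff[OF f])
    then show ?thesis
      using in_span_subset_iff_representation[OF S T, of "v - x"] v x
      by (simp add: real_vector.representation_diff[OF S] real_vector.span_diff)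
  qed
  show ?thesis
  proof
    assume "f v \<in> f ` (convex_cone hull S)"
    then obtain x where "x \<in> convex_cone hull S" "f v = f x" by blast
    then show "\<forall>s\<in>S - T. 0 \<le> ?r v s"
      using eq[of x] in_convex_cone_hull_iff_representation[OF fin S order_refl, of x] by auto
  next
    assume nonneg: "\<forall>s\<in>S - T. 0 \<le> ?r v s"
    define y where "y = (\<Sum>t\<in>T. ?r v t *\<^sub>R t)"
    define x where "x = (\<Sum>s\<in>S - T. ?r v s *\<^sub>R s)"
    have "v = x + y"
      using real_vector.sum_representation_eq[OF S v fin order_refl] sum.subset_diff[OF T fin]
      unfolding x_def y_def by metis
    moreover have "y \<in> span T"
      unfolding y_def by (intro real_vector.span_sum real_vector.span_scale real_vector.span_base)
    ultimately have "f v = f x" using ker[of y] by (simp add: real_vector.linear_add[OF f])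
    moreover have "x \<in> convex_cone hull S"
      unfolding x_def using nonneg
      by (intro convex_cone_sum convex_cone_convex_cone_hull convex_cone_hull_mul hull_inc) auto
    ultimately show "f v \<in> f ` (convex_cone hull S)" by blast
  qed
qed

section \<open>Cells below a given cell, and their generators\<close>

lemma multifan_cone_in_cones:
  "is_multifan \<Delta> \<Longrightarrow> I \<in> cells \<Delta> \<Longrightarrow> cone_of \<Delta> I \<in> cones (lattice \<Delta>)"
  by (simp add: is_multifan_def)

lemma multifan_cone_mono:
  assumes "is_multifan \<Delta>" "I \<in> cells \<Delta>" "J \<in> cells \<Delta>" "I \<le> J"
  shows "cone_of \<Delta> I \<subseteq> cone_of \<Delta> J"
proof (cases "I = J")
  case False
  then have "I < J" using assms(4) by simp
  then have "cone_of \<Delta> I face_of cone_of \<Delta> J"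
    using assms(1-3) by (simp add: is_multifan_def)
  then show ?thesis by (rule face_of_imp_subset)
qed simp

text \<open>This is the identification of \<Sigma> with a simplicial complex: cells below
  \<open>J\<close> correspond to faces of its cone by the multi-fan axioms, and faces correspond to
  sets of generators.\<close>

lemma bij_betw_cells_subsets:
  fixes \<Delta> :: "('i::order, 'a::real_vector) multifan"
  assumes mf: "is_multifan \<Delta>" and J: "J \<in> cells \<Delta>"
    and S: "finite S" "independent S" "cone_of \<Delta> J = convex_cone hull S"
  shows "bij_betw (\<lambda>K. S \<inter> cone_of \<Delta> K) {K \<in> cells \<Delta>. K \<le> J} (Pow S)"
    and "\<And>K. K \<in> cells \<Delta> \<Longrightarrow> K \<le> J \<Longrightarrow> cone_of \<Delta> K = convex_cone hull (S \<inter> cone_of \<Delta> K)"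
proof -
  note cone = multifan_cone_in_cones[OF mf]
  have bij: "bij_betw (cone_of \<Delta>) {K \<in> cells \<Delta>. K \<le> J}
      {\<kappa> \<in> cones (lattice \<Delta>). \<kappa> face_of convex_cone hull S}"
    using mf J by (simp add: is_multifan_def S(3)[symmetric])
  show "bij_betw (\<lambda>K. S \<inter> cone_of \<Delta> K) {K \<in> cells \<Delta>. K \<le> J} (Pow S)"
    using bij_betw_trans[OF bij bij_betw_faces_subsets[OF S(1,2)]] cone[OF J] S(3)
    by (simp add: comp_def)
  fix K assume K: "K \<in> cells \<Delta>" "K \<le> J"
  then have "cone_of \<Delta> K face_of convex_cone hull S"
    using bij_betwE[OF bij] by blast
  moreover have "cone_of \<Delta> K \<noteq> {}"
    using cone[OF K(1)] convex_cone_hull_nonempty unfolding cones_def by blast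
  ultimately show "cone_of \<Delta> K = convex_cone hull (S \<inter> cone_of \<Delta> K)"
    using face_of_convex_cone_hull[OF S(1)] by blast
qed

lemma in_ray_iff: "x \<in> convex_cone hull {s} \<longleftrightarrow> (\<exists>c\<ge>0. x = c *\<^sub>R s)"
proof -
  have "(\<exists>c. 0 \<le> c s \<and> x = c s *\<^sub>R s) \<longleftrightarrow> (\<exists>c\<ge>0. x = c *\<^sub>R s)"
    by (auto intro: exI[of _ "\<lambda>_. _"])
  then show ?thesis by (simp add: convex_cone_hull_finite)
qed

text \<open>Passes from the unspecified generators \<open>S\<close> supplied by
  \<open>simplicial\<close> to the prescribed vectors: each vertex of \<open>J\<close> corresponds
  to one element of \<open>S\<close>, of which \<open>u i\<close> is a positive multiple.\<close>

lemma simplicial_cell_generators: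
  fixes \<Delta> :: "('i::order, 'a::real_vector) multifan"
  assumes mf: "is_multifan \<Delta>" and simp: "simplicial \<Delta>" and J: "J \<in> cells \<Delta>"
    and u: "\<And>i. i \<in> cells_of_dim \<Delta> 1 \<Longrightarrow> u i \<in> cone_of \<Delta> i \<and> u i \<noteq> 0"
  shows "finite (vertices \<Delta> J)" and "inj_on u (vertices \<Delta> J)"
    and "independent (u ` vertices \<Delta> J)"
    and "cone_of \<Delta> J = convex_cone hull (u ` vertices \<Delta> J)"
proof -
  let ?V = "vertices \<Delta> J"
  obtain S where S: "finite S" "independent S" "cone_of \<Delta> J = convex_cone hull S"
    using simp J unfolding simplicial_def by blast
  note bij = bij_betw_cells_subsets(1)[OF mf J S]
  note cone = bij_betw_cells_subsets(2)[OF mf J S]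
  have dim_cone: "dim (cone_of \<Delta> K) = card (S \<inter> cone_of \<Delta> K)"
    if "K \<in> cells \<Delta>" "K \<le> J" for K
    using dim_convex_cone_hull[of "S \<inter> cone_of \<Delta> K"] cone[OF that] S(2)
      real_vector.dependent_mono by (metis Int_lower1)
  \<comment> \<open>Vertices, defined by dimension, become the cells that correspond to singletons
    in \<open>Pow S\<close>.\<close>
  have V: "i \<in> ?V \<longleftrightarrow> i \<in> cells \<Delta> \<and> i \<le> J \<and> card (S \<inter> cone_of \<Delta> i) = 1" for i
    unfolding vertices_def cells_of_dim_def using dim_cone by auto
  show fin: "finite ?V"
    using mf unfolding vertices_def cells_of_dim_def is_multifan_def by auto
  have "\<exists>s c. 0 < c \<and> s \<in> S \<and> S \<inter> cone_of \<Delta> i = {s} \<and> u i = c *\<^sub>R s" if i: "i \<in> ?V" for i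
  proof -
    obtain s where s: "S \<inter> cone_of \<Delta> i = {s}"
      using i V card_1_singletonE by metis
    have ui: "u i \<in> cone_of \<Delta> i" "u i \<noteq> 0"
      using u i unfolding vertices_def by auto
    have "cone_of \<Delta> i = convex_cone hull {s}"
      using cone[of i] i V s by simp
    then obtain c where "0 \<le> c" "u i = c *\<^sub>R s"
      using ui(1) in_ray_iff by blast
    then show ?thesis using s ui(2) by (intro exI[of _ s] exI[of _ c]) auto
  qed
  then obtain f c where f: "\<And>i. i \<in> ?V \<Longrightarrow> S \<inter> cone_of \<Delta> i = {f i}"
    and fS: "\<And>i. i \<in> ?V \<Longrightarrow> f i \<in> S" and c: "\<And>i. i \<in> ?V \<Longrightarrow> 0 < c i"
    and uf: "\<And>i. i \<in> ?V \<Longrightarrow> u i = c i *\<^sub>R f i"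
    by metis
  have f_onto: "f ` ?V = S"
  proof
    show "S \<subseteq> f ` ?V"
    proof
      fix s assume "s \<in> S"
      then have "{s} \<in> (\<lambda>K. S \<inter> cone_of \<Delta> K) ` {K \<in> cells \<Delta>. K \<le> J}"
        using bij unfolding bij_betw_def by simp
      then obtain i where i: "i \<in> cells \<Delta>" "i \<le> J" "S \<inter> cone_of \<Delta> i = {s}" by blast
      then have "i \<in> ?V" using V by simp
      then show "s \<in> f ` ?V" using f i(3) by blast
    qed
  qed (use fS in blast)
  have "inj_on f ?V"
  proof (rule inj_onI)
    fix i j assume "i \<in> ?V" "j \<in> ?V" "f i = f j"
    then have "S \<inter> cone_of \<Delta> i = S \<inter> cone_of \<Delta> j" using f by metis
    then show "i = j"
      using inj_onD[OF bij_betw_imp_inj_on[OF bij]] V \<open>i \<in> ?V\<close> \<open>j \<in> ?V\<close> by simp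
  qed
  then have card_V: "card ?V = card S" using f_onto card_image by metis
  have inv: "f i = inverse (c i) *\<^sub>R u i" if "i \<in> ?V" for i
    using uf[OF that] c[OF that] by simp
  \<comment> \<open>The scalars \<open>c i\<close> are positive, so each of the two generating sets
    lies in the cone spanned by the other.\<close>
  show hull: "cone_of \<Delta> J = convex_cone hull (u ` ?V)"
  proof -
    have "u i \<in> convex_cone hull S" if "i \<in> ?V" for i
      using uf fS c that by (simp add: convex_cone_hull_mul hull_inc less_imp_le)
    then have "convex_cone hull (u ` ?V) \<subseteq> convex_cone hull S"
      by (intro hull_minimal convex_cone_convex_cone_hull) auto
    moreover have "f i \<in> convex_cone hull (u ` ?V)" if "i \<in> ?V" for i
      using inv[OF that] c[OF that] that by (simp add: convex_cone_hull_mul hull_inc less_imp_le)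
    then have "convex_cone hull S \<subseteq> convex_cone hull (u ` ?V)"
      using f_onto by (intro hull_minimal convex_cone_convex_cone_hull) auto
    ultimately show ?thesis using S(3) by simp
  qed
  \<comment> \<open>Both remaining claims follow by counting: the vectors \<open>u i\<close> span
    \<open>S\<close> and number at most \<open>card ?V = card S\<close>, so they are independent;
    spanning also requires at least \<open>card S\<close> of them, so \<open>u\<close> is
    injective.\<close>
  have span: "S \<subseteq> span (u ` ?V)"
    using hull S(3) span_convex_cone_hull real_vector.span_superset by metis
  show "independent (u ` ?V)"
    using independent_if_card_le[OF _ S(2) span] card_image_le[OF fin, of u] card_V fin by simp
  have "card S \<le> card (u ` ?V)"
    using real_vector.independent_span_bound[OF _ S(2) span] fin by simp
  then show "inj_on u ?V"
    using card_V card_image_le[OF fin, of u] by (intro eq_card_imp_inj_on fin) simp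
qed

section \<open>Projected multi-fans and their degrees\<close>

lemma lattice_finite_span:
  assumes "is_lattice N"
  obtains F where "finite F" "N \<subseteq> span F"
proof -
  obtain B where B: "finite B" "N = range (\<lambda>c. \<Sum>b\<in>B. real_of_int (c b) *\<^sub>R b)"
    using assms unfolding is_lattice_def by blast
  have "N \<subseteq> span B"
    unfolding B(2) by (blast intro: real_vector.span_sum real_vector.span_scale real_vector.span_base)
  then show ?thesis using that B(1) by blast
qed

lemma cones_subset_span: "C \<in> cones N \<Longrightarrow> C \<subseteq> span N"
proof -
  assume "C \<in> cones N"
  then obtain S where "S \<subseteq> N" "C = convex_cone hull S"
    unfolding cones_def by blast
  then show "C \<subseteq> span N"
    by (metis span_convex_cone_hull real_vector.span_superset real_vector.span_mono order_trans)
qed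

text \<open>Rank and cone dimension both drop by \<open>dim (cone_of \<Delta> K)\<close>, so
  projection preserves codimension; in particular the top cells of the projection are the top cells
  of \<Delta> above \<open>K\<close>.\<close>

lemma projected_dims:
  fixes \<Delta> :: "('i::order, 'a::real_vector) multifan"
  assumes mf: "is_multifan \<Delta>" and K: "K \<in> cells \<Delta>"
  defines "\<pi> \<equiv> quotient_map (span (cone_of \<Delta> K))"
  shows "mf_rank (projected \<Delta> K) + dim (cone_of \<Delta> K) = mf_rank \<Delta>"
    and "\<And>J. J \<in> cells \<Delta> \<Longrightarrow> K \<le> J \<Longrightarrow>
      dim (\<pi> ` cone_of \<Delta> J) + dim (cone_of \<Delta> K) = dim (cone_of \<Delta> J)"
proof -
  have q: "linear \<pi>" "\<And>x. \<pi> x = 0 \<longleftrightarrow> x \<in> span (cone_of \<Delta> K)"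
    unfolding \<pi>_def by (simp_all add: quotient_map)
  have sub: "cone_of \<Delta> J \<subseteq> span (lattice \<Delta>)" if "J \<in> cells \<Delta>" for J
    using cones_subset_span[OF multifan_cone_in_cones[OF mf that]] .
  have "is_lattice (lattice \<Delta>)" using mf by (simp add: is_multifan_def)
  then obtain F where F: "finite F" "lattice \<Delta> \<subseteq> span F"
    by (rule lattice_finite_span)
  have subF: "cone_of \<Delta> J \<subseteq> span F" if "J \<in> cells \<Delta>" for J
    using sub[OF that] real_vector.span_minimal[OF F(2)] by auto
  show "mf_rank (projected \<Delta> K) + dim (cone_of \<Delta> K) = mf_rank \<Delta>"
    using dim_linear_image_add_dim_kernel[OF q sub[OF K] F]
    unfolding mf_rank_def projected_def \<pi>_def by (simp add: Let_def)
  fix J assume J: "J \<in> cells \<Delta>" "K \<le> J"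
  have "cone_of \<Delta> K \<subseteq> cone_of \<Delta> J"
    using multifan_cone_mono[OF mf K J] .
  then have "cone_of \<Delta> K \<subseteq> span (cone_of \<Delta> J)"
    using real_vector.span_superset by blast
  then show "dim (\<pi> ` cone_of \<Delta> J) + dim (cone_of \<Delta> K) = dim (cone_of \<Delta> J)"
    using dim_linear_image_add_dim_kernel[OF q _ F(1) subF[OF J(1)]] by blast
qed

text \<open>If the image of \<open>v\<close> lay in the span of the image of C(J), then
  \<open>v\<close> would differ from a point of span C(J) by an element of span C(K), which is
  contained in span C(J). As codimension is preserved, this contradicts genericity of
  \<open>v\<close>.\<close>

lemma generic_projected:
  fixes \<Delta> :: "('i::order, 'a::real_vector) multifan"
  assumes mf: "is_multifan \<Delta>" and K: "K \<in> cells \<Delta>" and v: "generic \<Delta> v"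
  shows "generic (projected \<Delta> K) (quotient_map (span (cone_of \<Delta> K)) v)"
proof -
  define \<pi> where "\<pi> = quotient_map (span (cone_of \<Delta> K))"
  have lin: "linear \<pi>" unfolding \<pi>_def by (simp add: quotient_map)
  have ker: "\<pi> x = 0 \<longleftrightarrow> x \<in> span (cone_of \<Delta> K)" for x
    unfolding \<pi>_def by (simp add: quotient_map)
  have "\<pi> v \<in> span (\<pi> ` lattice \<Delta>)"
    using v unfolding generic_def by (simp add: real_vector.linear_span_image[OF lin])
  moreover have "\<pi> v \<notin> span (\<pi> ` cone_of \<Delta> J)"
    if J: "J \<in> cells \<Delta>" "K \<le> J" and d: "dim (\<pi> ` cone_of \<Delta> J) < mf_rank (projected \<Delta> K)" for J
  proof
    assume "\<pi> v \<in> span (\<pi> ` cone_of \<Delta> J)"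
    then obtain x where x: "x \<in> span (cone_of \<Delta> J)" "\<pi> v = \<pi> x"
      by (auto simp: real_vector.linear_span_image[OF lin])
    then have "v - x \<in> span (cone_of \<Delta> K)" by (simp add: ker[symmetric] real_vector.linear_diff[OF lin])
    moreover have "cone_of \<Delta> K \<subseteq> cone_of \<Delta> J"
      using multifan_cone_mono[OF mf K J] .
    ultimately have "v - x \<in> span (cone_of \<Delta> J)"
      using real_vector.span_mono by blast
    then have "v \<in> span (cone_of \<Delta> J)"
      using x(1) real_vector.span_add by fastforce
    moreover have "dim (cone_of \<Delta> J) < mf_rank \<Delta>"
      using d projected_dims[OF mf K] J unfolding \<pi>_def by (metis add_less_cancel_right)
    ultimately show False using v J(1) unfolding generic_def by blast
  qed
  ultimately show ?thesis
    unfolding generic_def \<pi>_def[symmetric]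
    by (simp add: projected_def \<pi>_def[symmetric] Let_def)
qed

text \<open>The given generic vector pins down the value, which makes the definite description in
  \<open>mf_degree\<close> unique.\<close>

lemma mf_degree_eq_local_degree:
  assumes "pre_complete \<Delta>" "generic \<Delta> v"
  shows "mf_degree \<Delta> = local_degree \<Delta> v"
proof -
  obtain d where "\<forall>v. generic \<Delta> v \<longrightarrow> local_degree \<Delta> v = d"
    using assms(1) unfolding pre_complete_def by blast
  then show ?thesis
    using assms(2) unfolding mf_degree_def by (intro the_equality) auto
qed

text \<open>Rewrites the degree as a sum over top cells of \<Delta> itself, ready for exchanging
  summation over \<open>K\<close> and \<open>J\<close>.\<close>

lemma mf_degree_projected:
  fixes \<Delta> :: "('i::order, 'a::real_vector) multifan"
  assumes mf: "is_multifan \<Delta>" and compl: "complete_multifan \<Delta>" and K: "K \<in> cells \<Delta>"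
    and v: "generic \<Delta> v"
  defines "\<pi> \<equiv> quotient_map (span (cone_of \<Delta> K))"
  shows "mf_degree (projected \<Delta> K) =
    (\<Sum>J | J \<in> cells_of_dim \<Delta> (mf_rank \<Delta>) \<and> K \<le> J \<and> \<pi> v \<in> \<pi> ` cone_of \<Delta> J. weight \<Delta> J)"
proof -
  have "mf_degree (projected \<Delta> K) = local_degree (projected \<Delta> K) (\<pi> v)"
    unfolding \<pi>_def
  proof (rule mf_degree_eq_local_degree)
    show "pre_complete (projected \<Delta> K)" using compl K by (simp add: complete_multifan_def)
  qed (rule generic_projected[OF mf K v])
  moreover have "dim (\<pi> ` cone_of \<Delta> J) = mf_rank (projected \<Delta> K) \<longleftrightarrow>
      dim (cone_of \<Delta> J) = mf_rank \<Delta>" if "J \<in> cells \<Delta>" "K \<le> J" for J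
    using projected_dims(1)[OF mf K] projected_dims(2)[OF mf K that] unfolding \<pi>_def by linarith
  then have "{J \<in> cells_of_dim (projected \<Delta> K) (mf_rank (projected \<Delta> K)).
        \<pi> v \<in> cone_of (projected \<Delta> K) J}
      = {J \<in> cells_of_dim \<Delta> (mf_rank \<Delta>). K \<le> J \<and> \<pi> v \<in> \<pi> ` cone_of \<Delta> J}"
    unfolding cells_of_dim_def
    by (auto simp: projected_def Let_def \<pi>_def)
  moreover have "weight (projected \<Delta> K) J = weight \<Delta> J" for J
    by (simp add: weight_def projected_def Let_def)
  ultimately show ?thesis
    by (simp add: local_degree_def)
qed

section \<open>Counting the cells below a maximal cell\<close>

text \<open>Complementation in \<open>S\<close> turns these sets into the \<open>m\<close>-element
  subsets of \<open>P\<close>. The bound on \<open>m\<close> keeps the natural-number subtraction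
  exact.\<close>

lemma card_subsets_complement:
  assumes S: "finite S" and P: "P \<subseteq> S" and m: "m \<le> card S"
  shows "card {T \<in> Pow S. card T = card S - m \<and> S - T \<subseteq> P} = card P choose m"
proof -
  have "bij_betw (\<lambda>T. S - T) {T \<in> Pow S. card T = card S - m \<and> S - T \<subseteq> P}
      {R. R \<subseteq> P \<and> card R = m}"
    by (rule bij_betw_byWitness[where f' = "\<lambda>R. S - R"])
      (use S P m in \<open>auto simp: card_Diff_subset finite_subset double_diff intro: subset_trans\<close>)
  then show ?thesis
    using bij_betw_same_card n_subsets[OF finite_subset[OF P S], of m] by fastforce
qed

lemma bij_betw_restrict_vimage:
  assumes "bij_betw f X Y" "B \<subseteq> Y"
  shows "bij_betw f {x \<in> X. f x \<in> B} B"
  using assms by (auto simp: bij_betw_def inj_on_def)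

text \<open>For fixed \<open>J\<close>, cells \<open>K\<close> below \<open>J\<close> are replaced
  by sets of generators; the condition on \<open>K\<close> then says that all generators outside its
  set have positive coordinate.\<close>

lemma card_cells_image_in_cone:
  fixes \<Delta> :: "('i::order, 'a::real_vector) multifan"
  assumes mf: "is_multifan \<Delta>" and simp: "simplicial \<Delta>"
    and u: "\<And>i. i \<in> cells_of_dim \<Delta> 1 \<Longrightarrow> u i \<in> cone_of \<Delta> i \<and> u i \<noteq> 0"
    and v: "generic \<Delta> v" and J: "J \<in> cells_of_dim \<Delta> (mf_rank \<Delta>)"
  defines "\<pi> \<equiv> \<lambda>K. quotient_map (span (cone_of \<Delta> K))"
  shows "mu \<Delta> u v J \<le> mf_rank \<Delta>"
    and "m \<le> mf_rank \<Delta> \<Longrightarrow>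
      card {K \<in> cells_of_dim \<Delta> (mf_rank \<Delta> - m). K \<le> J \<and> \<pi> K v \<in> \<pi> K ` cone_of \<Delta> J} =
      mu \<Delta> u v J choose m"
proof -
  define S where "S = u ` vertices \<Delta> J"
  let ?r = "representation S v"
  have Jc: "J \<in> cells \<Delta>" and dimJ: "dim (cone_of \<Delta> J) = mf_rank \<Delta>"
    using J unfolding cells_of_dim_def by auto
  note gen = simplicial_cell_generators[OF mf simp Jc u]
  have S: "finite S" "independent S" "cone_of \<Delta> J = convex_cone hull S"
    using gen unfolding S_def by auto
  have cardS: "card S = mf_rank \<Delta>"
    using dimJ S(2,3) dim_convex_cone_hull by metis
  note bij = bij_betw_cells_subsets(1)[OF mf Jc S]
  note cone = bij_betw_cells_subsets(2)[OF mf Jc S]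
  have ind: "independent (S \<inter> X)" for X
    using S(2) real_vector.dependent_mono by (metis Int_lower1)
  have span: "span (cone_of \<Delta> K) = span (S \<inter> cone_of \<Delta> K)"
    and dim: "dim (cone_of \<Delta> K) = card (S \<inter> cone_of \<Delta> K)"
    if "K \<in> cells \<Delta>" "K \<le> J" for K
    using cone[OF that] span_convex_cone_hull dim_convex_cone_hull[OF ind] by metis+
  \<comment> \<open>C(J) has full dimension: \<open>S\<close> extends to a basis of
    \<open>span (lattice \<Delta>)\<close> of the same size, hence is that basis.\<close>
  have vS: "v \<in> span S"
  proof -
    have "is_lattice (lattice \<Delta>)" using mf by (simp add: is_multifan_def)
    then obtain F where F: "finite F" "lattice \<Delta> \<subseteq> span F"
      by (rule lattice_finite_span)
    have SN: "S \<subseteq> span (lattice \<Delta>)"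
      using cones_subset_span[OF multifan_cone_in_cones[OF mf Jc]] hull_subset[of S convex_cone]
      unfolding S(3) by simp
    obtain B where B: "S \<subseteq> B" "B \<subseteq> span (lattice \<Delta>)" "independent B" "span (lattice \<Delta>) \<subseteq> span B"
      using real_vector.maximal_independent_subset_extend[OF SN S(2)] by blast
    have "finite B"
      using real_vector.independent_span_bound[OF F(1) B(3)] B(2) real_vector.span_minimal[OF F(2)]
      by auto
    moreover have "card B = mf_rank \<Delta>"
      using real_vector.basis_card_eq_dim[OF B(2,4,3)] unfolding mf_rank_def by simp
    ultimately have "S = B" using B(1) cardS by (simp add: card_subset_eq)
    then show ?thesis using B(4) v unfolding generic_def by blast
  qed
  \<comment> \<open>A vanishing coordinate at \<open>s\<close> would place \<open>v\<close> in the
    span of the facet generated by \<open>S - {s}\<close>, which is the cone of a cell of smaller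
    dimension.\<close>
  have nonzero: "?r s \<noteq> 0" if s: "s \<in> S" for s
  proof
    assume "?r s = 0"
    then have vs: "v \<in> span (S - {s})"
      using in_span_subset_iff_representation[OF S(2), of "S - {s}"] vS by auto
    have "S - {s} \<in> (\<lambda>K. S \<inter> cone_of \<Delta> K) ` {K \<in> cells \<Delta>. K \<le> J}"
      using bij unfolding bij_betw_def by auto
    then obtain K where K: "K \<in> cells \<Delta>" "K \<le> J" "S \<inter> cone_of \<Delta> K = S - {s}" by auto
    have "dim (cone_of \<Delta> K) < mf_rank \<Delta>"
      using dim[OF K(1,2)] K(3) cardS S(1) s by (metis card_Diff1_less)
    then show False
      using v K vs span[OF K(1,2)] unfolding generic_def by metis
  qed
  define P where "P = {s \<in> S. 0 < ?r s}"
  have "P = u ` {i \<in> vertices \<Delta> J. 0 < ?r (u i)}"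
    unfolding P_def S_def by auto
  moreover have "inj_on u {i \<in> vertices \<Delta> J. 0 < ?r (u i)}"
    using gen(2) by (rule inj_on_subset) auto
  ultimately have cardP: "card P = mu \<Delta> u v J"
    unfolding mu_def S_def[symmetric] by (simp add: card_image)
  have "P \<subseteq> S" unfolding P_def by blast
  then show "mu \<Delta> u v J \<le> mf_rank \<Delta>"
    using cardP cardS card_mono[OF S(1)] by metis
  \<comment> \<open>The image criterion only yields nonnegative coordinates; genericity makes them
    strictly positive.\<close>
  have mem: "\<pi> K v \<in> \<pi> K ` cone_of \<Delta> J \<longleftrightarrow> S - S \<inter> cone_of \<Delta> K \<subseteq> P"
    if K: "K \<in> cells \<Delta>" "K \<le> J" for K
  proof -
    have "\<pi> K v \<in> \<pi> K ` cone_of \<Delta> J \<longleftrightarrow> (\<forall>s\<in>S - S \<inter> cone_of \<Delta> K. 0 \<le> ?r s)"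
      unfolding S(3) using span[OF K]
      by (intro linear_image_in_simplicial_cone_iff[OF S(1,2) Int_lower1 vS])
        (simp_all add: \<pi>_def quotient_map)
    also have "\<dots> \<longleftrightarrow> S - S \<inter> cone_of \<Delta> K \<subseteq> P"
      unfolding P_def using nonzero by (auto simp: less_le)
    finally show ?thesis .
  qed
  assume m: "m \<le> mf_rank \<Delta>"
  let ?A = "{K \<in> cells_of_dim \<Delta> (mf_rank \<Delta> - m). K \<le> J \<and> \<pi> K v \<in> \<pi> K ` cone_of \<Delta> J}"
  let ?B = "{T \<in> Pow S. card T = card S - m \<and> S - T \<subseteq> P}"
  have "?A = {K \<in> {K \<in> cells \<Delta>. K \<le> J}. S \<inter> cone_of \<Delta> K \<in> ?B}"
    using mem dim cardS unfolding cells_of_dim_def by auto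
  then have "bij_betw (\<lambda>K. S \<inter> cone_of \<Delta> K) ?A ?B"
    by (simp only:) (rule bij_betw_restrict_vimage[OF bij], blast)
  then have "card ?A = card ?B" by (rule bij_betw_same_card)
  also have "\<dots> = card P choose m"
    using card_subsets_complement[OF S(1) \<open>P \<subseteq> S\<close>] m cardS by simp
  finally show "card ?A = mu \<Delta> u v J choose m" using cardP by simp
qed

section \<open>The polynomial identity\<close>

lemma smult_sum_right: "smult c (sum f A) = (\<Sum>i\<in>A. smult c (f i))"
  by (induction A rule: infinite_finite_induct) (auto simp: smult_add_right)

theorem lemma3p1:
  fixes \<Delta> :: "('i::order, 'a::real_vector) multifan"
    and u :: "'i \<Rightarrow> 'a" and v :: 'a and n :: nat
  assumes "is_multifan \<Delta>" and "mf_rank \<Delta> = n"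
    and "complete_multifan \<Delta>" and "simplicial \<Delta>"
    and "\<And>i. i \<in> cells_of_dim \<Delta> 1 \<Longrightarrow> u i \<in> cone_of \<Delta> i \<and> u i \<noteq> 0"
    and "generic \<Delta> v"
  shows "(\<Sum>q=0..n. smult (h_number \<Delta> u v q) (([:0, 1:] + 1) ^ q)) =
         (\<Sum>m=0..n. smult (e_number \<Delta> (n - m)) ([:0, 1:] ^ m))"
proof -
  let ?T = "cells_of_dim \<Delta> n"
  let ?\<mu> = "mu \<Delta> u v"
  let ?X = "[:0, 1:] :: int poly"
  let ?w = "weight \<Delta>"
  define \<pi> where "\<pi> = (\<lambda>K. quotient_map (span (cone_of \<Delta> K)))"
  have finc: "finite (cells_of_dim \<Delta> q)" for q
    using assms(1) unfolding is_multifan_def cells_of_dim_def by simp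
  note count = card_cells_image_in_cone[OF assms(1,4,5,6), unfolded assms(2)]
  \<comment> \<open>Double counting of pairs \<open>K \<le> J\<close>: the conditions become
    \<open>if\<close>-terms so that the two index sets are independent and the sums can be
    swapped.\<close>
  have e: "e_number \<Delta> (n - m) = (\<Sum>J\<in>?T. ?w J * int (?\<mu> J choose m))" if m: "m \<le> n" for m
  proof -
    have "e_number \<Delta> (n - m) = (\<Sum>K\<in>cells_of_dim \<Delta> (n - m). \<Sum>J\<in>?T.
        if K \<le> J \<and> \<pi> K v \<in> \<pi> K ` cone_of \<Delta> J then ?w J else 0)"
      unfolding e_number_def
    proof (rule sum.cong[OF refl])
      fix K assume "K \<in> cells_of_dim \<Delta> (n - m)"
      then have "K \<in> cells \<Delta>" unfolding cells_of_dim_def by simp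
      then show "mf_degree (projected \<Delta> K) =
          (\<Sum>J\<in>?T. if K \<le> J \<and> \<pi> K v \<in> \<pi> K ` cone_of \<Delta> J then ?w J else 0)"
        using mf_degree_projected[OF assms(1,3) _ assms(6)] assms(2) finc
        by (simp add: \<pi>_def sum.inter_filter)
    qed
    also have "\<dots> = (\<Sum>J\<in>?T. \<Sum>K\<in>cells_of_dim \<Delta> (n - m).
        if K \<le> J \<and> \<pi> K v \<in> \<pi> K ` cone_of \<Delta> J then ?w J else 0)"
      by (rule sum.swap)
    also have "\<dots> = (\<Sum>J\<in>?T. ?w J * int (?\<mu> J choose m))"
      using count(2)[OF _ _ m] finc
      by (intro sum.cong refl) (simp add: \<pi>_def sum.inter_filter[symmetric])
    finally show ?thesis .
  qed
  have "(\<Sum>q=0..n. smult (h_number \<Delta> u v q) ((?X + 1) ^ q)) =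
      (\<Sum>q=0..n. \<Sum>J | J \<in> ?T \<and> ?\<mu> J = q. smult (?w J) ((?X + 1) ^ ?\<mu> J))"
    unfolding h_number_def assms(2) by (intro sum.cong refl) (simp add: smult_sum)
  \<comment> \<open>The classes \<mu>(J) = q with q \<le> n exhaust the top cells, since \<mu>(J)
    \<le> n.\<close>
  also have "\<dots> = (\<Sum>J\<in>?T. smult (?w J) ((?X + 1) ^ ?\<mu> J))"
    using count(1) finc by (intro sum.group) auto
  also have "\<dots> = (\<Sum>J\<in>?T. \<Sum>m=0..n. smult (?w J * int (?\<mu> J choose m)) (?X ^ m))"
  proof (intro sum.cong refl)
    fix J assume "J \<in> ?T"
    \<comment> \<open>The binomial sum stops at \<mu>(J); extending it to \<open>n\<close> adds only
      zero terms, as the binomial coefficients vanish there.\<close>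
    then have "(?X + 1) ^ ?\<mu> J = (\<Sum>m\<in>{0..n}. of_nat (?\<mu> J choose m) * ?X ^ m)"
      using count(1)[of J] by (simp add: binomial_ring) (intro sum.mono_neutral_left, auto)
    then show "smult (?w J) ((?X + 1) ^ ?\<mu> J) =
        (\<Sum>m=0..n. smult (?w J * int (?\<mu> J choose m)) (?X ^ m))"
      by (simp add: smult_sum_right of_nat_poly)
  qed
  also have "\<dots> = (\<Sum>m=0..n. smult (e_number \<Delta> (n - m)) (?X ^ m))"
    by (subst sum.swap) (simp add: e smult_sum)
  finally show ?thesis .
qed

end
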